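(* Let $X,Y$ be Polish spaces and let $c:X\times Y\to[0,\infty)$ be a continuous cost function with $c(x,y)\le c_X(x)+c_Y(y)$ for all $(x,y)$, where $c_X:X\to\mathbb{R}$ and $c_Y:Y\to\mathbb{R}$ are fixed measurable functions. Let $\mu\in\mathscr{P}_c(X)$ and let $K$ be a $c_X$-bounded Markov kernel from $X$ to $Y$. Then the product measure $\gamma:=\mu\odot K$ has finite transport cost, $\int_{X\times Y}c\,d\gamma<\infty$, and $\mu K\in\mathscr{P}_c(Y)$. If $K$ is additionally an optimal transport kernel, then $\gamma$ is an optimal coupling between $\mu$ and $\mu K$.
   Context: $\mathscr{P}(Z)$ denotes the Borel probability measures on a Polish space $Z$; $\mathscr{P}_c(X)=\{\mu\in\mathscr{P}(X): c_X\in L^1(\mu)\}$ and $\mathscr{P}_c(Y)=\{\nu\in\mathscr{P}(Y): c_Y\in L^1(\nu)\}$. A Markov kernel $K$ from $X$ to $Y$ is a map $(x,B)\mapsto K(x,B)$ that is Borel measurable in $x$ for every Borel set $B\subset Y$ and a probability measure in $B$ for every $x\in X$. For a measure $\mu$ on $X$, $\mu K$ is the measure on $Y$ given by $\mu K(B)=\int_X K(x,B)\,d\mu(x)$, and $\mu\odot K$ is the measure on $X\times Y$ given by $\int f\,d(\mu\odot K)=\int_X d\mu(x)\int_Y f(x,y)K(x,dy)$ for non-negative measurable $f$. $K$ is $c_X$-bounded if there are finite constants $A,B$ such that $\int_Y c_Y(y)K(x,dy)<A\,c_X(x)+B$ for all $x\in X$. A coupling of $\mu$ and $\nu$ is a probability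 measure on $X\times Y$ with marginals $\mu$ and $\nu$; it is optimal if it minimizes $\int c\,d\gamma$ among all couplings of $\mu$ and $\nu$; $C(\mu,\nu)$ denotes the infimum of this cost. $K$ is an optimal transport kernel (for $c$) if for every $\mu\in\mathscr{P}(X)$ such that $C(\mu,\mu K)<\infty$, the measure $\mu\odot K$ is an optimal coupling between $\mu$ and $\mu K$. *)

theory Defs
  imports "HOL-Probability.Probability"
begin

abbreviation borel_probs :: "'a::topological_space measure set"
  where "borel_probs \<equiv> space (prob_algebra borel)"

definition integrable_probs :: "('a::topological_space \<Rightarrow> real) \<Rightarrow> 'a measure set"
  where "integrable_probs h = {\<mu> \<in> borel_probs. integrable \<mu> h}"

definition markov_kernel :: "('a::topological_space \<Rightarrow> 'b::topological_space measure) \<Rightarrow> bool"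
  where "markov_kernel K \<longleftrightarrow> K \<in> borel \<rightarrow>\<^sub>M prob_algebra borel"

lemma markov_kernel_iff:
  "markov_kernel K \<longleftrightarrow>
     (\<forall>x. sets (K x) = sets borel \<and> prob_space (K x)) \<and>
     (\<forall>B\<in>sets borel. (\<lambda>x. emeasure (K x) B) \<in> borel_measurable borel)"
proof
  assume "markov_kernel K"
  then have K: "K \<in> borel \<rightarrow>\<^sub>M prob_algebra borel"
    by (simp add: markov_kernel_def)
  have "K x \<in> space (prob_algebra borel)" for x
    using measurable_space[OF K] by simp
  moreover have "(\<lambda>x. emeasure (K x) B) \<in> borel_measurable borel" if "B \<in> sets borel" for B
    using measurable_prob_algebraD[OF K] that by (rule measurable_emeasure_kernel)
  ultimately show "(\<forall>x. sets (K x) = sets borel \<and> prob_space (K x)) \<and>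
     (\<forall>B\<in>sets borel. (\<lambda>x. emeasure (K x) B) \<in> borel_measurable borel)"
    by (simp add: space_prob_algebra)
next
  assume *: "(\<forall>x. sets (K x) = sets borel \<and> prob_space (K x)) \<and>
     (\<forall>B\<in>sets borel. (\<lambda>x. emeasure (K x) B) \<in> borel_measurable borel)"
  then have "K \<in> borel \<rightarrow>\<^sub>M subprob_algebra borel"
    by (intro measurable_subprob_algebra) (auto intro: prob_space_imp_subprob_space)
  with * show "markov_kernel K"
    by (auto simp: markov_kernel_def intro!: measurable_prob_algebraI)
qed

text \<open>The measure \<open>\<mu>K\<close> is rendered as \<open>\<mu> \<bind> K\<close>; its defining property is \<open>emeasure_bind_prob_algebra\<close>.
  The product measure below is characterised by \<open>nn_integral_kernel_prod\<close>.\<close>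

definition kernel_prod ::
    "'a::topological_space measure \<Rightarrow> ('a \<Rightarrow> 'b::topological_space measure) \<Rightarrow> ('a \<times> 'b) measure"
    (infixl "\<odot>\<^sub>K" 54)
  where "\<mu> \<odot>\<^sub>K K = \<mu> \<bind> (\<lambda>x. distr (K x) borel (Pair x))"

lemma nn_integral_kernel_prod:
  fixes K :: "'a::second_countable_topology \<Rightarrow> 'b::second_countable_topology measure"
  assumes \<mu>: "\<mu> \<in> borel_probs" and K: "markov_kernel K" and f: "f \<in> borel_measurable borel"
  shows "(\<integral>\<^sup>+z. f z \<partial>(\<mu> \<odot>\<^sub>K K)) = (\<integral>\<^sup>+x. (\<integral>\<^sup>+y. f (x, y) \<partial>K x) \<partial>\<mu>)"
proof -
  have sets_\<mu>: "sets \<mu> = sets borel"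
    using \<mu> by (simp add: space_prob_algebra)
  have K': "K \<in> \<mu> \<rightarrow>\<^sub>M subprob_algebra borel"
    using K measurable_prob_algebraD
    by (auto simp: markov_kernel_def measurable_cong_sets[OF sets_\<mu> refl])
  have sets_K: "sets (K x) = sets borel" for x
    using K by (simp add: markov_kernel_iff)
  have Pair_meas: "Pair x \<in> K x \<rightarrow>\<^sub>M borel" for x
    unfolding measurable_cong_sets[OF sets_K refl]
    by (intro borel_measurable_continuous_onI continuous_intros)
  have "case_prod Pair \<in> \<mu> \<Otimes>\<^sub>M borel \<rightarrow>\<^sub>M (borel :: ('a \<times> 'b) measure)"
    by (simp add: borel_prod[symmetric]
        measurable_cong_sets[OF sets_pair_measure_cong[OF sets_\<mu> refl] refl])
  then have "(\<lambda>x. distr (K x) borel (Pair x)) \<in> \<mu> \<rightarrow>\<^sub>M subprob_algebra (borel :: ('a \<times> 'b) measure)"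
    using K' by (rule measurable_distr2)
  then show ?thesis
    unfolding kernel_prod_def
    by (simp add: nn_integral_bind[where B = borel] nn_integral_distr[OF Pair_meas] f)
qed

text \<open>Integrability is part of the condition: otherwise \<open>\<integral>y. c\<^sub>Y y \<partial>K x\<close> would be \<open>0\<close> when the
  mathematical value is \<open>\<infinity>\<close>. In the presence of \<open>0 \<le> c (x, y) \<le> c\<^sub>X x + c\<^sub>Y y\<close> the function \<open>c\<^sub>Y\<close> is
  bounded below, so finiteness of its integral is the same as integrability.\<close>

definition kernel_bounded ::
    "('a \<Rightarrow> real) \<Rightarrow> ('b \<Rightarrow> real) \<Rightarrow> ('a \<Rightarrow> 'b measure) \<Rightarrow> bool"
  where "kernel_bounded c\<^sub>X c\<^sub>Y K \<longleftrightarrow>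
    (\<exists>A B. \<forall>x. integrable (K x) c\<^sub>Y \<and> (\<integral>y. c\<^sub>Y y \<partial>K x) < A * c\<^sub>X x + B)"

definition couplings ::
    "'a::topological_space measure \<Rightarrow> 'b::topological_space measure \<Rightarrow> ('a \<times> 'b) measure set"
  where "couplings \<mu> \<nu> =
    {\<gamma> \<in> borel_probs. distr \<gamma> borel fst = \<mu> \<and> distr \<gamma> borel snd = \<nu>}"

text \<open>Used for \<open>c \<ge> 0\<close> only, since \<open>ennreal\<close> truncates negative values.\<close>

definition transport_cost :: "('a \<times> 'b \<Rightarrow> real) \<Rightarrow> ('a \<times> 'b) measure \<Rightarrow> ennreal"
  where "transport_cost c \<gamma> = (\<integral>\<^sup>+z. ennreal (c z) \<partial>\<gamma>)"

definition optimal_cost ::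
    "('a::topological_space \<times> 'b::topological_space \<Rightarrow> real) \<Rightarrow> 'a measure \<Rightarrow> 'b measure \<Rightarrow> ennreal"
  where "optimal_cost c \<mu> \<nu> = (INF \<gamma>\<in>couplings \<mu> \<nu>. transport_cost c \<gamma>)"

definition optimal_coupling ::
    "('a::topological_space \<times> 'b::topological_space \<Rightarrow> real) \<Rightarrow> 'a measure \<Rightarrow> 'b measure
      \<Rightarrow> ('a \<times> 'b) measure \<Rightarrow> bool"
  where "optimal_coupling c \<mu> \<nu> \<gamma> \<longleftrightarrow>
    \<gamma> \<in> couplings \<mu> \<nu> \<and> (\<forall>\<gamma>'\<in>couplings \<mu> \<nu>. transport_cost c \<gamma> \<le> transport_cost c \<gamma>')"

definition optimal_transport_kernel ::
    "('a::topological_space \<times> 'b::topological_space \<Rightarrow> real) \<Rightarrow> ('a \<Rightarrow> 'b measure) \<Rightarrow> bool"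
  where "optimal_transport_kernel c K \<longleftrightarrow>
    markov_kernel K \<and>
    (\<forall>\<mu>\<in>borel_probs. optimal_cost c \<mu> (\<mu> \<bind> K) < \<infinity> \<longrightarrow>
        optimal_coupling c \<mu> (\<mu> \<bind> K) (\<mu> \<odot>\<^sub>K K))"

end

theory Submission
  imports Defs
begin

text \<open>Fix \<open>x\<close> and integrate
  \<open>c (x, y) \<le> c\<^sub>X x + c\<^sub>Y y\<close> over the probability measure
  \<open>K x\<close>. The kernel bound makes the result at most
  \<open>(1 + A) * c\<^sub>X x + B\<close>, which is integrable because \<open>c\<^sub>X\<close> is
  \<mu>-integrable. By \<open>nn_integral_kernel_prod\<close>, the iterated integral is the
  transport cost, so the cost is finite. For the second claim, \<open>c \<ge> 0\<close> forces
  \<open>c\<^sub>Y\<close> to be at least minus the value of \<open>c\<^sub>X\<close> at any fixed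
  point. Shifting by that constant \<open>m\<close> makes \<open>c\<^sub>Y\<close> non-negative, and
  the same estimate with \<open>m\<close> in place of \<open>c\<^sub>X x\<close> bounds its integral
  under \<open>\<mu> \<bind> K\<close>. Both estimates are instances of
  \<open>nn_integral_kernel_le_affine\<close>. For optimality, the product measure is itself a
  coupling (\<open>kernel_prod_in_couplings\<close>). Its finite cost therefore makes the optimal
  cost finite, which is the condition under which an optimal transport kernel guarantees optimality
  (\<open>optimal_coupling_kernel_prod\<close>).\<close>

lemma space_bind_prob_algebra:
  assumes M: "M \<in> space (prob_algebra N)" and f: "f \<in> N \<rightarrow>\<^sub>M prob_algebra L"
  shows "M \<bind> f \<in> space (prob_algebra L)"
  using prob_space_bind'[OF M f] sets_bind'[OF M f] by (simp add: space_prob_algebra)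

text \<open>Sending \<open>x\<close> to the image of \<open>K x\<close> under \<open>Pair x\<close>
  is again a Markov kernel, now into the product space, so averaging it over \<mu> yields a
  probability measure.\<close>

lemma kernel_prod_in_borel_probs:
  fixes K :: "'a::second_countable_topology \<Rightarrow> 'b::second_countable_topology measure"
  assumes \<mu>: "\<mu> \<in> borel_probs" and K: "markov_kernel K"
  shows "\<mu> \<odot>\<^sub>K K \<in> borel_probs"
proof -
  \<comment> \<open>Second countability enters here: through \<open>borel_prod\<close>, the product
    of the two Borel sigma-algebras is the Borel sigma-algebra of the product space.\<close>
  have "case_prod Pair \<in> borel \<Otimes>\<^sub>M borel \<rightarrow>\<^sub>M (borel :: ('a \<times> 'b) measure)"
    by (simp add: borel_prod)
  moreover have "K \<in> borel \<rightarrow>\<^sub>M prob_algebra borel"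
    using K by (simp add: markov_kernel_def)
  ultimately have "(\<lambda>x. distr (K x) borel (Pair x)) \<in> borel \<rightarrow>\<^sub>M prob_algebra (borel :: ('a \<times> 'b) measure)"
    by (rule measurable_distr_prob_space2[rotated])
  then show ?thesis
    using \<mu> unfolding kernel_prod_def by (auto intro!: space_bind_prob_algebra)
qed

lemma emeasure_kernel_prod:
  fixes K :: "'a::second_countable_topology \<Rightarrow> 'b::second_countable_topology measure"
  assumes \<mu>: "\<mu> \<in> borel_probs" and K: "markov_kernel K" and S: "S \<in> sets borel"
  shows "emeasure (\<mu> \<odot>\<^sub>K K) S = (\<integral>\<^sup>+x. (\<integral>\<^sup>+y. indicator S (x, y) \<partial>K x) \<partial>\<mu>)"
proof -
  have "sets (\<mu> \<odot>\<^sub>K K) = sets borel"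
    using kernel_prod_in_borel_probs[OF \<mu> K] by (simp add: space_prob_algebra)
  then have "emeasure (\<mu> \<odot>\<^sub>K K) S = (\<integral>\<^sup>+z. indicator S z \<partial>(\<mu> \<odot>\<^sub>K K))"
    using S by simp
  also have "\<dots> = (\<integral>\<^sup>+x. (\<integral>\<^sup>+y. indicator S (x, y) \<partial>K x) \<partial>\<mu>)"
    using \<mu> K S by (intro nn_integral_kernel_prod) auto
  finally show ?thesis .
qed

text \<open>Evaluate the product measure on cylinders. Over \<open>fst -\<close>
  S\<open>the inner integral is\<close>indicator S x\<open>, since\<close>K
  x\<open>has mass one. Over\<close>snd -\<open>S\<close> it is \<open>emeasure (K x) S\<close>,
  whose \<mu>-average is the value of \<open>\<mu> \<bind> K\<close> on \<open>S\<close>.\<close>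

lemma kernel_prod_in_couplings:
  fixes K :: "'a::second_countable_topology \<Rightarrow> 'b::second_countable_topology measure"
  assumes \<mu>: "\<mu> \<in> borel_probs" and K: "markov_kernel K"
  shows "\<mu> \<odot>\<^sub>K K \<in> couplings \<mu> (\<mu> \<bind> K)"
proof -
  let ?\<gamma> = "\<mu> \<odot>\<^sub>K K"
  have \<gamma>: "?\<gamma> \<in> borel_probs"
    using \<mu> K by (rule kernel_prod_in_borel_probs)
  have sets_\<mu>: "sets \<mu> = sets borel" and sets_\<gamma>: "sets ?\<gamma> = sets borel"
    using \<mu> \<gamma> by (simp_all add: space_prob_algebra)
  have sets_K: "sets (K x) = sets borel" and prob_K: "prob_space (K x)" for x
    using K by (simp_all add: markov_kernel_iff)
  have K': "K \<in> borel \<rightarrow>\<^sub>M prob_algebra borel"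
    using K by (simp add: markov_kernel_def)
  have bind: "\<mu> \<bind> K \<in> borel_probs"
    using \<mu> K' by (auto intro!: space_bind_prob_algebra)
  have space: "space ?\<gamma> = UNIV"
    using sets_eq_imp_space_eq[OF sets_\<gamma>] by simp
  have fst: "fst \<in> ?\<gamma> \<rightarrow>\<^sub>M borel" and snd: "snd \<in> ?\<gamma> \<rightarrow>\<^sub>M borel"
    unfolding measurable_cong_sets[OF sets_\<gamma> refl]
    by (intro borel_measurable_continuous_onI continuous_intros)+
  have "distr ?\<gamma> borel fst = \<mu>"
  proof (rule measure_eqI)
    fix S assume "S \<in> sets (distr ?\<gamma> borel fst)"
    then have S: "S \<in> sets borel" by simp
    have "fst -` S \<in> sets ?\<gamma>"
      using measurable_sets[OF fst S] by (simp add: space)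
    then have "emeasure (distr ?\<gamma> borel fst) S =
        (\<integral>\<^sup>+x. (\<integral>\<^sup>+y. indicator (fst -` S) (x, y) \<partial>K x) \<partial>\<mu>)"
      using \<mu> K S by (simp add: emeasure_distr[OF fst] space emeasure_kernel_prod sets_\<gamma>)
    also have "\<dots> = (\<integral>\<^sup>+x. indicator S x \<partial>\<mu>)"
      by (intro nn_integral_cong)
        (simp add: indicator_def prob_space.emeasure_space_1[OF prob_K])
    finally show "emeasure (distr ?\<gamma> borel fst) S = emeasure \<mu> S"
      using S by (simp add: sets_\<mu>)
  qed (simp add: sets_\<mu>)
  moreover have "distr ?\<gamma> borel snd = \<mu> \<bind> K"
  proof (rule measure_eqI)
    fix S assume "S \<in> sets (distr ?\<gamma> borel snd)"
    then have S: "S \<in> sets borel" by simp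
    have "snd -` S \<in> sets ?\<gamma>"
      using measurable_sets[OF snd S] by (simp add: space)
    then have "emeasure (distr ?\<gamma> borel snd) S =
        (\<integral>\<^sup>+x. (\<integral>\<^sup>+y. indicator (snd -` S) (x, y) \<partial>K x) \<partial>\<mu>)"
      using \<mu> K S by (simp add: emeasure_distr[OF snd] space emeasure_kernel_prod sets_\<gamma>)
    also have "\<dots> = (\<integral>\<^sup>+x. (\<integral>\<^sup>+y. indicator S y \<partial>K x) \<partial>\<mu>)"
      by (simp add: indicator_def)
    also have "\<dots> = (\<integral>\<^sup>+x. emeasure (K x) S \<partial>\<mu>)"
      using S by (simp add: sets_K)
    also have "\<dots> = emeasure (\<mu> \<bind> K) S"
      using emeasure_bind_prob_algebra[OF \<mu> K' S] by simp
    finally show "emeasure (distr ?\<gamma> borel snd) S = emeasure (\<mu> \<bind> K) S" .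
  qed (use bind in \<open>simp add: space_prob_algebra\<close>)
  ultimately show ?thesis
    using \<gamma> by (simp add: couplings_def)
qed

text \<open>The product measure competes in the infimum defining \<open>optimal_cost\<close>, so its
  own finite cost supplies the finiteness demanded by
  \<open>optimal_transport_kernel\<close>.\<close>

lemma optimal_coupling_kernel_prod:
  fixes K :: "'a::second_countable_topology \<Rightarrow> 'b::second_countable_topology measure"
  assumes \<mu>: "\<mu> \<in> borel_probs" and K: "optimal_transport_kernel c K"
    and cost: "transport_cost c (\<mu> \<odot>\<^sub>K K) < \<infinity>"
  shows "optimal_coupling c \<mu> (\<mu> \<bind> K) (\<mu> \<odot>\<^sub>K K)"
proof -
  have "\<mu> \<odot>\<^sub>K K \<in> couplings \<mu> (\<mu> \<bind> K)"
    using \<mu> K by (intro kernel_prod_in_couplings) (simp_all add: optimal_transport_kernel_def)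
  then have "optimal_cost c \<mu> (\<mu> \<bind> K) \<le> transport_cost c (\<mu> \<odot>\<^sub>K K)"
    unfolding optimal_cost_def by (rule INF_lower)
  also note cost
  finally show ?thesis
    using \<mu> K by (simp add: optimal_transport_kernel_def)
qed

text \<open>Non-negativity of \<open>a + h y\<close> means that \<open>ennreal\<close> truncates
  nothing, so the integral can be computed as a real one; the constant \<open>a\<close> integrates
  to itself because \<open>M\<close> has mass one. It is applied with \<open>M = K x\<close>,
  \<open>h = c\<^sub>Y\<close> and \<open>b = A * c\<^sub>X x + B\<close>.\<close>

lemma nn_integral_kernel_le_affine:
  fixes h :: "'b \<Rightarrow> real" and u :: "'a \<Rightarrow> real"
  assumes prob: "prob_space M" and h: "integrable M h" and le: "(\<integral>y. h y \<partial>M) \<le> b"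
    and nonneg: "\<And>y. 0 \<le> a + h y"
  shows "(\<integral>\<^sup>+y. ennreal (a + h y) \<partial>M) \<le> ennreal (a + b)"
proof -
  interpret prob_space M by (rule prob)
  have "(\<integral>\<^sup>+y. ennreal (a + h y) \<partial>M) = ennreal (\<integral>y. a + h y \<partial>M)"
    using h nonneg by (intro nn_integral_eq_integral) auto
  also have "(\<integral>y. a + h y \<partial>M) = a + (\<integral>y. h y \<partial>M)"
    using h by (simp add: prob_space)
  finally show ?thesis
    using le by (simp add: ennreal_leI)
qed

theorem theorem4p3:
  fixes c :: "'a::polish_space \<times> 'b::polish_space \<Rightarrow> real"
    and c\<^sub>X :: "'a \<Rightarrow> real" and c\<^sub>Y :: "'b \<Rightarrow> real"
    and \<mu> :: "'a measure" and K :: "'a \<Rightarrow> 'b measure"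
  assumes "continuous_on UNIV c"
    and "\<And>x y. 0 \<le> c (x, y)"
    and "c\<^sub>X \<in> borel_measurable borel" and "c\<^sub>Y \<in> borel_measurable borel"
    and "\<And>x y. c (x, y) \<le> c\<^sub>X x + c\<^sub>Y y"
    and "\<mu> \<in> integrable_probs c\<^sub>X"
    and "markov_kernel K" and "kernel_bounded c\<^sub>X c\<^sub>Y K"
  shows "transport_cost c (\<mu> \<odot>\<^sub>K K) < \<infinity> \<and>
    \<mu> \<bind> K \<in> integrable_probs c\<^sub>Y \<and>
    (optimal_transport_kernel c K \<longrightarrow> optimal_coupling c \<mu> (\<mu> \<bind> K) (\<mu> \<odot>\<^sub>K K))"
proof -
  obtain A B where int_K: "\<And>x. integrable (K x) c\<^sub>Y"
    and bound: "\<And>x. (\<integral>y. c\<^sub>Y y \<partial>K x) \<le> A * c\<^sub>X x + B"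
    using assms(8) unfolding kernel_bounded_def by (meson less_imp_le)
  have \<mu>: "\<mu> \<in> borel_probs" and int_\<mu>: "integrable \<mu> c\<^sub>X"
    using assms(6) by (simp_all add: integrable_probs_def)
  interpret \<mu>: prob_space \<mu>
    using \<mu> by (simp add: space_prob_algebra)
  have sets_\<mu>: "sets \<mu> = sets borel"
    using \<mu> by (simp add: space_prob_algebra)
  have prob_K: "prob_space (K x)" for x
    using assms(7) by (simp add: markov_kernel_iff)
  have K': "K \<in> borel \<rightarrow>\<^sub>M prob_algebra borel"
    using assms(7) by (simp add: markov_kernel_def)
  have K'': "K \<in> \<mu> \<rightarrow>\<^sub>M subprob_algebra borel"
    using measurable_prob_algebraD[OF K'] by (simp add: measurable_cong_sets[OF sets_\<mu> refl])
  have nonneg: "0 \<le> c\<^sub>X x + c\<^sub>Y y" for x y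
    using assms(2,5) order_trans by blast
  \<comment> \<open>The signs of \<open>p\<close> and \<open>q\<close> are arbitrary, so
    \<open>ennreal\<close> may truncate the integrand; domination by the norm covers every case. The
    uses are \<open>p = 1 + A\<close>, \<open>q = B\<close> and \<open>p = A\<close>,
    \<open>q = m + B\<close>.\<close>
  have affine: "(\<integral>\<^sup>+x. ennreal (p * c\<^sub>X x + q) \<partial>\<mu>) < \<infinity>" for p q
  proof -
    have "integrable \<mu> (\<lambda>x. p * c\<^sub>X x + q)"
      using int_\<mu> by simp
    then have "(\<integral>\<^sup>+x. ennreal (norm (p * c\<^sub>X x + q)) \<partial>\<mu>) < \<infinity>"
      by (simp add: integrable_iff_bounded)
    then show ?thesis
      by (rule le_less_trans[rotated]) (auto intro!: nn_integral_mono ennreal_leI)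
  qed
  have cost: "transport_cost c (\<mu> \<odot>\<^sub>K K) < \<infinity>"
  proof -
    have "c \<in> borel_measurable borel"
      using assms(1) by (rule borel_measurable_continuous_onI)
    then have "transport_cost c (\<mu> \<odot>\<^sub>K K) = (\<integral>\<^sup>+x. (\<integral>\<^sup>+y. ennreal (c (x, y)) \<partial>K x) \<partial>\<mu>)"
      unfolding transport_cost_def
      by (intro nn_integral_kernel_prod[OF \<mu> assms(7)]) simp
    also have "\<dots> \<le> (\<integral>\<^sup>+x. (\<integral>\<^sup>+y. ennreal (c\<^sub>X x + c\<^sub>Y y) \<partial>K x) \<partial>\<mu>)"
      by (intro nn_integral_mono ennreal_leI assms(5))
    \<comment> \<open>In the inner integral \<open>x\<close> is frozen, so
      \<open>c\<^sub>X x\<close> acts as the constant \<open>a\<close>.\<close>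
    also have "\<dots> \<le> (\<integral>\<^sup>+x. ennreal (c\<^sub>X x + (A * c\<^sub>X x + B)) \<partial>\<mu>)"
      by (intro nn_integral_mono nn_integral_kernel_le_affine prob_K int_K bound nonneg)
    also have "\<dots> = (\<integral>\<^sup>+x. ennreal ((1 + A) * c\<^sub>X x + B) \<partial>\<mu>)"
      by (simp add: algebra_simps)
    also note affine
    finally show ?thesis .
  qed
  have "integrable (\<mu> \<bind> K) c\<^sub>Y"
  proof -
    \<comment> \<open>Freezing one point of \<open>X\<close> shows that \<open>c\<^sub>Y\<close> is bounded below.\<close>
    define m where "m = c\<^sub>X undefined"
    have sets_bind: "sets (\<mu> \<bind> K) = sets borel"
      using space_bind_prob_algebra[OF \<mu> K'] by (simp add: space_prob_algebra)
    interpret bind: prob_space "\<mu> \<bind> K"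
      using space_bind_prob_algebra[OF \<mu> K'] by (simp add: space_prob_algebra)
    have m: "0 \<le> m + c\<^sub>Y y" for y
      unfolding m_def by (rule nonneg)
    \<comment> \<open>After the shift the integrand is non-negative, so the integral against
      \<open>\<mu> \<bind> K\<close> unfolds into an iterated one before any integrability is
      known.\<close>
    have "(\<integral>\<^sup>+y. ennreal (m + c\<^sub>Y y) \<partial>(\<mu> \<bind> K)) = (\<integral>\<^sup>+x. (\<integral>\<^sup>+y. ennreal (m + c\<^sub>Y y) \<partial>K x) \<partial>\<mu>)"
      using assms(4) by (intro nn_integral_bind[OF _ K'']) simp
    also have "\<dots> \<le> (\<integral>\<^sup>+x. ennreal (m + (A * c\<^sub>X x + B)) \<partial>\<mu>)"
      by (intro nn_integral_mono nn_integral_kernel_le_affine prob_K int_K bound m)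
    also have "\<dots> = (\<integral>\<^sup>+x. ennreal (A * c\<^sub>X x + (m + B)) \<partial>\<mu>)"
      by (simp add: algebra_simps)
    also note affine
    finally have "integrable (\<mu> \<bind> K) (\<lambda>y. m + c\<^sub>Y y)"
      using assms(4) m
      by (intro integrableI_nonneg) (simp_all add: measurable_cong_sets[OF sets_bind refl])
    \<comment> \<open>The shift is undone: constants are integrable for the probability measure
      \<open>\<mu> \<bind> K\<close>.\<close>
    then have "integrable (\<mu> \<bind> K) (\<lambda>y. (m + c\<^sub>Y y) - m)"
      by (intro Bochner_Integration.integrable_diff) simp_all
    then show ?thesis by simp
  qed
  then have "\<mu> \<bind> K \<in> integrable_probs c\<^sub>Y"
    using space_bind_prob_algebra[OF \<mu> K'] by (simp add: integrable_probs_def)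
  with cost optimal_coupling_kernel_prod[OF \<mu> _ cost] show ?thesis
    by blast
qed

end
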